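(* Let $1\to K\to G\to H\to 1$ be a short exact sequence of groups such that $K$ is a countable group with straight finite decomposition complexity, $G$ is finitely generated, and $H$ has a decomposition complexity growth function $s$. Then $G$ has a decomposition complexity growth function $t$ with $t\sim s$.
   Context: $\mathbb{R}^+$ denotes the positive reals. A finitely generated group is regarded as a metric space with a word length metric $d(g,h)=|g^{-1}h|_S$, where $S$ is a finite symmetric generating set and $|g|_S$ is the length of a shortest word in $S$ representing $g$ (here this applies to $G$ and its quotient $H$). A countable group is regarded as a metric space with a proper (locally finite) left-invariant metric, which exists and is unique up to coarse equivalence (here this applies to $K$). For nonempty subsets $A,B$ of a metric space, $d(A,B)=\inf\{d(a,b):a\in A,b\in B\}$. For $R>0$, a family $\mathcal{U}$ of nonempty subsets of a metric space is $R$-disjoint if $d(A,B)>R$ for all $A,B\in\mathcal{U}$ with $A\neq B$. A metric family is a family of metric spaces (subsets of a metric space carry the restricted metric); it is uniformly bounded if the supremum of the diameters of its members is finite. A metric space $X$ $(R,n)$-decomposes over a metric family $\mathcal{V}$, written $X\stackrel{R,n}{\longrightarrow}\mathcal{V}$, if there is a family $\mathcal{U}=\mathcal{U}_1\cup\dots\cup\mathcal{U}_n$ of subsets of $X$ covering $X$ such that each $\mathcal{U}_i$ is $R$-disjoint and $\mathcal{U}\subset\mathcal{V}$. For metric families, $\mathcal{U}\stackrel{R,n}{\longrightarrow}\mathcal{V}$ means that every member of $\mathcal{U}$ $(R,n)$-decomposes over $\mathcal{V}$. A non-decreasing function $s:\mathbb{R}^+\to\mathbb{N}$ is a decomposition complexity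 growth function for a metric space $X$ if for every sequence $R_1\le R_2\le\cdots$ of positive reals there exist a positive integer $n$ and metric families $\mathcal{V}_1,\dots,\mathcal{V}_n$ with $$X\stackrel{R_1,s(R_1)}{\longrightarrow}\mathcal{V}_1\stackrel{R_2,s(R_2)}{\longrightarrow}\mathcal{V}_2\stackrel{R_3,s(R_3)}{\longrightarrow}\cdots\stackrel{R_n,s(R_n)}{\longrightarrow}\mathcal{V}_n$$ and $\mathcal{V}_n$ uniformly bounded. A metric space has straight finite decomposition complexity (sFDC) if the same holds with every $s(R_i)$ replaced by $2$, i.e. for every sequence $R_1\le R_2\le\cdots$ of positive reals there exist a positive integer $n$ and metric families with $X\stackrel{R_1,2}{\longrightarrow}\mathcal{V}_1\stackrel{R_2,2}{\longrightarrow}\cdots\stackrel{R_n,2}{\longrightarrow}\mathcal{V}_n$ and $\mathcal{V}_n$ uniformly bounded. Non-decreasing functions $s,t:\mathbb{R}^+\to\mathbb{N}$ have the same growth, written $s\sim t$, if there are constants $a,c>0$ such that $s(ax)\ge t(x)-c$ and $t(ax)\ge s(x)-c$ for all $x>0$. *)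

theory Defs
  imports "HOL-Analysis.Analysis" "HOL-Algebra.Algebra"
begin

section \<open>Decompositions of metric families\<close>

text \<open>
  Metric spaces are elements of the library type \<open>'a metric\<close>, and a metric family is a set
  of them. A subset \<open>A\<close> of \<open>m\<close> belongs to a metric family via its restricted metric,
  \<open>submetric m A\<close>.
\<close>

definition set_mdist :: "'a metric \<Rightarrow> 'a set \<Rightarrow> 'a set \<Rightarrow> real" where
  "set_mdist m A B = Inf {mdist m a b | a b. a \<in> A \<and> b \<in> B}"

definition R_disjoint :: "'a metric \<Rightarrow> real \<Rightarrow> 'a set set \<Rightarrow> bool" where
  "R_disjoint m R \<U> \<longleftrightarrow>
     (\<forall>A\<in>\<U>. A \<noteq> {} \<and> A \<subseteq> mspace m) \<and>
     (\<forall>A\<in>\<U>. \<forall>B\<in>\<U>. A \<noteq> B \<longrightarrow> set_mdist m A B > R)"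

definition decomposes :: "'a metric \<Rightarrow> real \<Rightarrow> nat \<Rightarrow> 'a metric set \<Rightarrow> bool" where
  "decomposes m R n \<V> \<longleftrightarrow>
     (\<exists>\<U> :: nat \<Rightarrow> 'a set set.
        (\<forall>i\<in>{1..n}. R_disjoint m R (\<U> i)) \<and>
        \<Union>(\<Union>i\<in>{1..n}. \<U> i) = mspace m \<and>
        submetric m ` (\<Union>i\<in>{1..n}. \<U> i) \<subseteq> \<V>)"

definition family_decomposes :: "'a metric set \<Rightarrow> real \<Rightarrow> nat \<Rightarrow> 'a metric set \<Rightarrow> bool" where
  "family_decomposes \<W> R n \<V> \<longleftrightarrow> (\<forall>m\<in>\<W>. decomposes m R n \<V>)"

text \<open>
  The diameter is extended-real valued, so that unbounded spaces have diameter \<open>\<infinity>\<close>.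
  Empty suprema are \<open>-\<infinity>\<close>, which counts as bounded.
\<close>

definition mdiam :: "'a metric \<Rightarrow> ereal" where
  "mdiam m = (SUP x\<in>mspace m. SUP y\<in>mspace m. ereal (mdist m x y))"

definition uniformly_bounded_family :: "'a metric set \<Rightarrow> bool" where
  "uniformly_bounded_family \<V> \<longleftrightarrow> (SUP m\<in>\<V>. mdiam m) < \<infinity>"

text \<open>
  \<open>R 0, R 1, \<dots>\<close> is the sequence of radii usually written \<open>R\<^sub>1, R\<^sub>2, \<dots>\<close>; the chain
  of families starts with the singleton family \<open>\<V> 0 = {m}\<close>. The function \<open>k\<close> gives the
  number of colours allowed at each radius.
\<close>

definition decomposable_with :: "'a metric \<Rightarrow> (real \<Rightarrow> nat) \<Rightarrow> bool" where
  "decomposable_with m k \<longleftrightarrow>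
     (\<forall>R :: nat \<Rightarrow> real. (\<forall>i. 0 < R i) \<and> (\<forall>i. R i \<le> R (Suc i)) \<longrightarrow>
        (\<exists>n \<V>. 0 < n \<and> \<V> 0 = {m} \<and>
           (\<forall>i<n. family_decomposes (\<V> i) (R i) (k (R i)) (\<V> (Suc i))) \<and>
           uniformly_bounded_family (\<V> n)))"

text \<open>
  A function on the positive reals is a function on \<open>real\<close> of which only the values at
  positive arguments are ever used.
\<close>

definition decomposition_complexity_growth :: "'a metric \<Rightarrow> (real \<Rightarrow> nat) \<Rightarrow> bool" where
  "decomposition_complexity_growth m s \<longleftrightarrow> mono_on {0<..} s \<and> decomposable_with m s"

definition straight_FDC :: "'a metric \<Rightarrow> bool" where
  "straight_FDC m \<longleftrightarrow> decomposable_with m (\<lambda>_. 2)"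

definition same_growth :: "(real \<Rightarrow> nat) \<Rightarrow> (real \<Rightarrow> nat) \<Rightarrow> bool" where
  "same_growth s t \<longleftrightarrow>
     (\<exists>a>0. \<exists>c>0. \<forall>x>0.
        real (s (a * x)) \<ge> real (t x) - c \<and> real (t (a * x)) \<ge> real (s x) - c)"

section \<open>Metrics on groups\<close>

definition symmetric_generating_set :: "('a, 'b) monoid_scheme \<Rightarrow> 'a set \<Rightarrow> bool" where
  "symmetric_generating_set G S \<longleftrightarrow>
     S \<subseteq> carrier G \<and> (\<forall>x\<in>S. inv\<^bsub>G\<^esub> x \<in> S) \<and> generate G S = carrier G"

definition word_length :: "('a, 'b) monoid_scheme \<Rightarrow> 'a set \<Rightarrow> 'a \<Rightarrow> nat" where
  "word_length G S g =
     (LEAST n. \<exists>ws. set ws \<subseteq> S \<and> length ws = n \<and> foldr (\<otimes>\<^bsub>G\<^esub>) ws \<one>\<^bsub>G\<^esub> = g)"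

text \<open>
  The value \<open>0\<close> outside the carrier is irrelevant; it only serves to make the distance function
  total, symmetric and nonnegative, as the type \<open>'a metric\<close> requires.
\<close>

definition word_dist :: "('a, 'b) monoid_scheme \<Rightarrow> 'a set \<Rightarrow> 'a \<Rightarrow> 'a \<Rightarrow> real" where
  "word_dist G S g h =
     (if g \<in> carrier G \<and> h \<in> carrier G
      then real (word_length G S (inv\<^bsub>G\<^esub> g \<otimes>\<^bsub>G\<^esub> h)) else 0)"

definition word_metric :: "('a, 'b) monoid_scheme \<Rightarrow> 'a set \<Rightarrow> 'a metric" where
  "word_metric G S = metric (carrier G, word_dist G S)"

definition proper_left_invariant_metric :: "('a, 'b) monoid_scheme \<Rightarrow> 'a metric \<Rightarrow> bool" where
  "proper_left_invariant_metric G m \<longleftrightarrow>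
     mspace m = carrier G \<and>
     (\<forall>g\<in>carrier G. \<forall>x\<in>carrier G. \<forall>y\<in>carrier G.
        mdist m (g \<otimes>\<^bsub>G\<^esub> x) (g \<otimes>\<^bsub>G\<^esub> y) = mdist m x y) \<and>
     (\<forall>x r. finite (mcball_of m x r))"

text \<open>The word metric is a metric, so \<open>word_metric\<close> has the intended points and distances.\<close>

context
  fixes G (structure) and S
  assumes G: "group G" and S: "symmetric_generating_set G S"
begin

interpretation group G by (rule G)

lemma generators_closed: "S \<subseteq> carrier G" "x \<in> S \<Longrightarrow> inv x \<in> S"
  using S by (auto simp: symmetric_generating_set_def)

lemma word_closed: "set ws \<subseteq> S \<Longrightarrow> foldr (\<otimes>) ws \<one> \<in> carrier G"
  using generators_closed(1) by (induction ws) auto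

lemma word_append:
  "set us \<subseteq> S \<Longrightarrow> set vs \<subseteq> S \<Longrightarrow>
    foldr (\<otimes>) (us @ vs) \<one> = foldr (\<otimes>) us \<one> \<otimes> foldr (\<otimes>) vs \<one>"
proof (induction us)
  case Nil
  then show ?case using word_closed by simp
next
  case (Cons a us)
  then show ?case
    using word_closed[of us] word_closed[of vs] generators_closed(1) by (auto simp: m_assoc subset_iff)
qed

lemma word_inverse:
  "set ws \<subseteq> S \<Longrightarrow> \<exists>vs. set vs \<subseteq> S \<and> length vs = length ws \<and>
     foldr (\<otimes>) vs \<one> = inv (foldr (\<otimes>) ws \<one>)"
proof (induction ws)
  case Nil
  then show ?case by simp
next
  case (Cons a ws)
  then obtain vs where vs: "set vs \<subseteq> S" "length vs = length ws"
    "foldr (\<otimes>) vs \<one> = inv (foldr (\<otimes>) ws \<one>)" by auto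
  have a: "a \<in> carrier G" "inv a \<in> S" "set ws \<subseteq> S" using Cons.prems generators_closed by auto
  have "foldr (\<otimes>) (vs @ [inv a]) \<one> = inv (foldr (\<otimes>) ws \<one>) \<otimes> inv a"
    using vs a word_append[of vs "[inv a]"] by simp
  also have "\<dots> = inv (foldr (\<otimes>) (a # ws) \<one>)"
    using a word_closed[of ws] by (simp add: inv_mult_group)
  finally show ?case using vs a by (intro exI[of _ "vs @ [inv a]"]) auto
qed

lemma word_exists:
  assumes "g \<in> carrier G" shows "\<exists>ws. set ws \<subseteq> S \<and> foldr (\<otimes>) ws \<one> = g"
proof -
  have "g \<in> generate G S" using assms S by (simp add: symmetric_generating_set_def)
  then show ?thesis
  proof (induction rule: generate.induct)
    case one
    then show ?case by (intro exI[of _ "[]"]) simp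
  next
    case (incl h)
    then show ?case using generators_closed(1) by (intro exI[of _ "[h]"]) auto
  next
    case (inv h)
    then show ?case using generators_closed by (intro exI[of _ "[m_inv G h]"]) auto
  next
    case (eng h1 h2)
    then obtain us vs where "set us \<subseteq> S" "foldr (\<otimes>) us \<one> = h1"
      "set vs \<subseteq> S" "foldr (\<otimes>) vs \<one> = h2" by auto
    then show ?case using word_append by (intro exI[of _ "us @ vs"]) auto
  qed
qed

lemma word_length_attained:
  assumes "g \<in> carrier G"
  shows "\<exists>ws. set ws \<subseteq> S \<and> length ws = word_length G S g \<and> foldr (\<otimes>) ws \<one> = g"
  unfolding word_length_def by (rule LeastI_ex) (use word_exists[OF assms] in auto)

lemma word_length_le: "set ws \<subseteq> S \<Longrightarrow> word_length G S (foldr (\<otimes>) ws \<one>) \<le> length ws"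
  unfolding word_length_def by (rule Least_le) auto

lemma word_length_mult_le:
  assumes "g \<in> carrier G" "h \<in> carrier G"
  shows "word_length G S (g \<otimes> h) \<le> word_length G S g + word_length G S h"
proof -
  obtain us vs where "set us \<subseteq> S" "length us = word_length G S g" "foldr (\<otimes>) us \<one> = g"
    "set vs \<subseteq> S" "length vs = word_length G S h" "foldr (\<otimes>) vs \<one> = h"
    using word_length_attained assms by metis
  then show ?thesis using word_length_le[of "us @ vs"] word_append[of us vs] by simp
qed

lemma word_length_inv_le: "g \<in> carrier G \<Longrightarrow> word_length G S (inv g) \<le> word_length G S g"
  using word_length_attained[of g] word_inverse word_length_le by metis

lemma word_length_inv: "g \<in> carrier G \<Longrightarrow> word_length G S (inv g) = word_length G S g"
  using word_length_inv_le[of g] word_length_inv_le[of "inv g"] by simp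

lemma word_length_eq_0: "g \<in> carrier G \<Longrightarrow> word_length G S g = 0 \<longleftrightarrow> g = \<one>"
  using word_length_attained[of g] word_length_le[of "[]"] by auto

lemma Metric_space_word_dist: "Metric_space (carrier G) (word_dist G S)"
proof
  show "0 \<le> word_dist G S x y" for x y by (simp add: word_dist_def)
  show "word_dist G S x y = word_dist G S y x" for x y
    using word_length_inv[of "inv x \<otimes> y"] by (auto simp: word_dist_def inv_mult_group)
  show "word_dist G S x y = 0 \<longleftrightarrow> x = y" if "x \<in> carrier G" "y \<in> carrier G" for x y
    using that word_length_eq_0[of "inv x \<otimes> y"] 
    by (auto simp: word_dist_def) (metis inv_closed inv_equality inv_inv)
  show "word_dist G S x z \<le> word_dist G S x y + word_dist G S y z"
    if "x \<in> carrier G" "y \<in> carrier G" "z \<in> carrier G" for x y z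
  proof -
    have "inv x \<otimes> z = (inv x \<otimes> y) \<otimes> (inv y \<otimes> z)"
      using that by (metis inv_closed m_assoc m_closed r_inv r_one)
    then show ?thesis
      using that word_length_mult_le[of "inv x \<otimes> y" "inv y \<otimes> z"] by (simp add: word_dist_def)
  qed
qed

lemma mspace_word_metric: "mspace (word_metric G S) = carrier G"
  unfolding word_metric_def by (rule Metric_space.mspace_metric[OF Metric_space_word_dist])

lemma mdist_word_metric: "mdist (word_metric G S) = word_dist G S"
  unfolding word_metric_def by (rule Metric_space.mdist_metric[OF Metric_space_word_dist])

end

end

theory Submission
  imports Defs
begin

text \<open>
  If \<open>\<pi>\<close> is \<open>L\<close>-Lipschitz, a decomposition chain of \<open>H\<close> at the radii \<open>2 L R\<^sub>i\<close> pulls back along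
  \<open>\<pi>\<close> to one of \<open>G\<close> at the radii \<open>R\<^sub>i\<close>. It ends in preimages of sets of diameter at most some
  \<open>D\<close>; left translates of these lie in a bounded neighbourhood of the kernel, so they embed
  coarsely into \<open>K\<close> with common control functions. Hence a chain for \<open>K\<close>, at radii depending on
  \<open>D\<close> and the remaining \<open>R\<^sub>i\<close>, pulls back as well and completes the chain for \<open>G\<close>. Thus
  \<open>t R = max (s (2 L R)) 2\<close> works.
\<close>

section \<open>Pulling back decompositions\<close>

lemma uniformly_bounded_family_iff:
  "uniformly_bounded_family \<V> \<longleftrightarrow>
    (\<exists>D. \<forall>m\<in>\<V>. \<forall>x\<in>mspace m. \<forall>y\<in>mspace m. mdist m x y \<le> D)"
proof
  assume "uniformly_bounded_family \<V>"
  then obtain D where "(SUP m\<in>\<V>. mdiam m) \<le> ereal D"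
    unfolding uniformly_bounded_family_def
    by (metis less_PInf_Ex_of_nat less_imp_le order_less_irrefl)
  then show "\<exists>D. \<forall>m\<in>\<V>. \<forall>x\<in>mspace m. \<forall>y\<in>mspace m. mdist m x y \<le> D"
    by (auto simp: mdiam_def SUP_le_iff)
next
  assume "\<exists>D. \<forall>m\<in>\<V>. \<forall>x\<in>mspace m. \<forall>y\<in>mspace m. mdist m x y \<le> D"
  then obtain D where "(SUP m\<in>\<V>. mdiam m) \<le> ereal D"
    by (auto simp: mdiam_def SUP_le_iff)
  then show "uniformly_bounded_family \<V>"
    unfolding uniformly_bounded_family_def by (rule le_less_trans) simp
qed

lemma family_decomposes_mono:
  "family_decomposes \<W> R n \<V> \<Longrightarrow> \<V> \<subseteq> \<V>' \<Longrightarrow> family_decomposes \<W> R n \<V>'"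
  unfolding family_decomposes_def decomposes_def by (meson order_trans)

lemma set_mdist_le: "a \<in> A \<Longrightarrow> b \<in> B \<Longrightarrow> set_mdist m A B \<le> mdist m a b"
  unfolding set_mdist_def by (intro cInf_lower bdd_belowI[of _ 0]) auto

text \<open>Nonemptiness keeps the infimum from being taken over the empty set, where
  \<open>Inf\<close> on the reals carries no information.\<close>

lemma set_mdist_ge:
  "A \<noteq> {} \<Longrightarrow> B \<noteq> {} \<Longrightarrow> (\<And>a b. a \<in> A \<Longrightarrow> b \<in> B \<Longrightarrow> r \<le> mdist m a b) \<Longrightarrow> r \<le> set_mdist m A B"
  unfolding set_mdist_def by (intro cInf_greatest) auto

text \<open>
  The room between \<open>R\<close> and \<open>R'\<close> is needed because distances \<open>> R\<close> between points only give an
  infimum \<open>\<ge> R\<close>, while \<open>R_disjoint\<close> is strict; this is where the factor 2 in the growth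
  function comes from.
\<close>
lemma decomposes_submetric_pullback:
  assumes Z: "Z \<subseteq> mspace m" and B: "B \<subseteq> mspace m'" and R: "R < R'" and k: "k \<le> k'"
    and control: "\<And>x y. x \<in> Z \<Longrightarrow> y \<in> Z \<Longrightarrow> mdist m x y \<le> R' \<Longrightarrow> mdist m' (f x) (f y) \<le> \<rho>"
    and dec: "decomposes (submetric m' B) \<rho> k \<V>"
  shows "decomposes (submetric m {x\<in>Z. f x \<in> B}) R k'
    {submetric m {x\<in>Z. f x \<in> C} |C. C \<subseteq> mspace m' \<and> submetric m' C \<in> \<V>}"
proof -
  have "mspace (submetric m' B) = B" using B by auto
  then have "\<exists>\<U>. (\<forall>i\<in>{1..k}. R_disjoint (submetric m' B) \<rho> (\<U> i)) \<and>
      \<Union>(\<Union>i\<in>{1..k}. \<U> i) = B \<and> submetric (submetric m' B) ` (\<Union>i\<in>{1..k}. \<U> i) \<subseteq> \<V>"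
    using dec unfolding decomposes_def by simp
  then obtain \<U> where
    disj: "\<And>i. i \<in> {1..k} \<Longrightarrow> R_disjoint (submetric m' B) \<rho> (\<U> i)"
    and cover: "\<Union>(\<Union>i\<in>{1..k}. \<U> i) = B"
    and img: "submetric (submetric m' B) ` (\<Union>i\<in>{1..k}. \<U> i) \<subseteq> \<V>" by blast
  have mem: "submetric (submetric m' B) C \<in> \<V>" if "i \<in> {1..k}" "C \<in> \<U> i" for i C
    using img that by blast
  define P where "P C = {x\<in>Z. f x \<in> C}" for C
  \<comment> \<open>Empty preimages are discarded because \<open>R_disjoint\<close> admits only
    nonempty members; the surplus colours between \<open>k\<close> and \<open>k'\<close> get no
    sets.\<close>
  define \<U>' where "\<U>' i = (if i \<le> k then P ` \<U> i - {{}} else {})" for i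
  have sub: "C \<subseteq> B" if "i \<in> {1..k}" "C \<in> \<U> i" for i C
    using cover that by blast
  have Un: "(\<Union>i\<in>{1..k'}. \<U>' i) = P ` (\<Union>i\<in>{1..k}. \<U> i) - {{}}"
  proof -
    have "(\<Union>i\<in>{1..k'}. \<U>' i) = (\<Union>i\<in>{1..k}. P ` \<U> i - {{}})"
    proof (rule equalityI; rule UN_least)
      show "\<U>' i \<subseteq> (\<Union>i\<in>{1..k}. P ` \<U> i - {{}})" if "i \<in> {1..k'}" for i
        using that unfolding \<U>'_def by (cases "i \<le> k") fastforce+
      show "P ` \<U> i - {{}} \<subseteq> (\<Union>i\<in>{1..k'}. \<U>' i)" if "i \<in> {1..k}" for i
        using that k by (intro SUP_upper2[of i]) (auto simp: \<U>'_def)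
    qed
    then show ?thesis by blast
  qed
  have "R_disjoint (submetric m (P B)) R (\<U>' i)" if "i \<in> {1..k'}" for i
  proof (cases "i \<le> k")
    case True
    then have i: "i \<in> {1..k}" using that by auto
    have "R < set_mdist (submetric m (P B)) (P C) (P D)"
      if CD: "C \<in> \<U> i" "D \<in> \<U> i" "P C \<noteq> {}" "P D \<noteq> {}" "P C \<noteq> P D" for C D
    proof -
      have *: "\<rho> < set_mdist (submetric m' B) C D"
        using disj[OF i] CD by (auto simp: R_disjoint_def)
      \<comment> \<open>Points of \<open>P C\<close> and \<open>P D\<close> within distance
        \<open>R'\<close> would have images within \<open>\<rho>\<close>, against the separation of
        \<open>C\<close> and \<open>D\<close>. Passing to the infimum weakens the strict inequality,
        and \<open>R < R'\<close> restores it.\<close>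
      have "R' \<le> set_mdist (submetric m (P B)) (P C) (P D)"
      proof (rule set_mdist_ge)
        fix x y assume xy: "x \<in> P C" "y \<in> P D"
        then have "\<rho> < mdist m' (f x) (f y)"
          using less_le_trans[OF * set_mdist_le[of "f x" C "f y" D]] by (simp add: P_def)
        then show "R' \<le> mdist (submetric m (P B)) x y"
          using control[of x y] xy by (force simp: P_def)
      qed (use CD in auto)
      then show ?thesis using R by simp
    qed
    moreover have "P C \<subseteq> P B" if "C \<in> \<U> i" for C
      using sub[OF i that] by (auto simp: P_def)
    moreover have "P C \<subseteq> mspace m" for C
      using Z by (auto simp: P_def)
    ultimately have "R_disjoint (submetric m (P B)) R (P ` {C \<in> \<U> i. P C \<noteq> {}})"
      unfolding R_disjoint_def ball_simps by (simp only: mem_Collect_eq mspace_submetric) simp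
    moreover have "P ` {C \<in> \<U> i. P C \<noteq> {}} = P ` \<U> i - {{}}" by auto
    ultimately show ?thesis using True by (simp add: \<U>'_def)
  qed (simp add: \<U>'_def R_disjoint_def)
  moreover have "\<Union>(\<Union>i\<in>{1..k'}. \<U>' i) = mspace (submetric m (P B))"
  proof -
    have "\<Union>(\<Union>i\<in>{1..k'}. \<U>' i) = \<Union>(P ` (\<Union>i\<in>{1..k}. \<U> i))" unfolding Un by blast
    also have "\<dots> = P (\<Union>(\<Union>i\<in>{1..k}. \<U> i))" unfolding P_def by blast
    also have "\<dots> = mspace (submetric m (P B))"
      unfolding cover using Z by (auto simp: P_def)
    finally show ?thesis .
  qed
  moreover have "submetric (submetric m (P B)) ` (\<Union>i\<in>{1..k'}. \<U>' i) \<subseteq>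
      {submetric m (P C) |C. C \<subseteq> mspace m' \<and> submetric m' C \<in> \<V>}"
  proof -
    have "submetric (submetric m (P B)) (P C) \<in>
        {submetric m (P C) |C. C \<subseteq> mspace m' \<and> submetric m' C \<in> \<V>}"
      if i: "i \<in> {1..k}" and C: "C \<in> \<U> i" for i C
    proof -
      \<comment> \<open>Restricting twice means restricting to the intersection, so the pieces are
        direct submetrics of \<open>m\<close> and \<open>m'\<close>.\<close>
      have eq: "P B \<inter> P C = P C" "B \<inter> C = C" using sub[OF i C] by (auto simp: P_def)
      then have "submetric m' C \<in> \<V>" "C \<subseteq> mspace m'"
        using mem[OF i C] sub[OF i C] B by simp_all
      then show ?thesis unfolding submetric_submetric eq by blast
    qed
    then show ?thesis unfolding Un by blast
  qed
  ultimately have "decomposes (submetric m (P B)) R k'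
      {submetric m (P C) |C. C \<subseteq> mspace m' \<and> submetric m' C \<in> \<V>}"
    unfolding decomposes_def by (intro exI[of _ \<U>'] conjI ballI)
  then show ?thesis unfolding P_def .
qed

text \<open>Each domain \<open>Z\<close> carries its own map \<open>f\<close>, since the pieces left
  over from the quotient embed into the kernel by different maps. For the quotient map itself
  \<open>F\<close> is a singleton.\<close>

definition pullback_family ::
  "'a metric \<Rightarrow> 'b metric \<Rightarrow> ('a set \<times> ('a \<Rightarrow> 'b)) set \<Rightarrow> 'b metric set \<Rightarrow> 'a metric set" where
  "pullback_family m m' F \<V> =
     {submetric m {x\<in>Z. f x \<in> B} |Z f B. (Z, f) \<in> F \<and> B \<subseteq> mspace m' \<and> submetric m' B \<in> \<V>}"

text \<open>A member is decomposed with the same \<open>f\<close> that defines it, so its pieces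
  stay in the pullback family. The members interact only through the bound \<open>\<rho>\<close>,
  which must be common to all of \<open>F\<close>.\<close>

lemma family_decomposes_pullback:
  assumes "\<And>Z f. (Z, f) \<in> F \<Longrightarrow> Z \<subseteq> mspace m"
    and "\<And>Z f x y. (Z, f) \<in> F \<Longrightarrow> x \<in> Z \<Longrightarrow> y \<in> Z \<Longrightarrow> mdist m x y \<le> R' \<Longrightarrow>
           mdist m' (f x) (f y) \<le> \<rho>"
    and "R < R'" and "k \<le> k'" and "family_decomposes \<V> \<rho> k \<V>'"
  shows "family_decomposes (pullback_family m m' F \<V>) R k' (pullback_family m m' F \<V>')"
  unfolding family_decomposes_def
proof
  fix M assume "M \<in> pullback_family m m' F \<V>"
  then obtain Z f B where F: "(Z, f) \<in> F" and B: "B \<subseteq> mspace m'" "submetric m' B \<in> \<V>"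
    and M: "M = submetric m {x\<in>Z. f x \<in> B}"
    by (auto simp: pullback_family_def)
  have "decomposes M R k' {submetric m {x\<in>Z. f x \<in> C} |C. C \<subseteq> mspace m' \<and> submetric m' C \<in> \<V>'}"
    unfolding M
    using assms(1)[OF F] B(1) assms(3,4) assms(2)[OF F]
    by (rule decomposes_submetric_pullback)
      (use assms(5) B(2) in \<open>auto simp: family_decomposes_def\<close>)
  moreover have "{submetric m {x\<in>Z. f x \<in> C} |C. C \<subseteq> mspace m' \<and> submetric m' C \<in> \<V>'}
      \<subseteq> pullback_family m m' F \<V>'"
    using F by (auto simp: pullback_family_def)
  ultimately show "decomposes M R k' (pullback_family m m' F \<V>')"
    unfolding decomposes_def by (meson order_trans)
qed

section \<open>Fibering\<close>

text \<open>The control functions are parameters, so that one pair can serve a whole family of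
  domains. The lower control is stated in inverse form: \<open>\<eta>\<close> bounds how far apart
  points with close images can be.\<close>

definition coarse_embedding_on ::
  "'a metric \<Rightarrow> 'b metric \<Rightarrow> (real \<Rightarrow> real) \<Rightarrow> (real \<Rightarrow> real) \<Rightarrow> 'a set \<Rightarrow> ('a \<Rightarrow> 'b) \<Rightarrow> bool" where
  "coarse_embedding_on m m' \<rho> \<eta> Z f \<longleftrightarrow> f \<in> Z \<rightarrow> mspace m' \<and>
     (\<forall>x\<in>Z. \<forall>y\<in>Z. \<forall>r. (mdist m x y \<le> r \<longrightarrow> mdist m' (f x) (f y) \<le> \<rho> r) \<and>
                       (mdist m' (f x) (f y) \<le> r \<longrightarrow> mdist m x y \<le> \<eta> r))"

text \<open>The order of choices is what makes this work. The chain for \<open>m'\<close> yields its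
  final bound \<open>D\<close> before \<open>mK\<close> is used, so the controls may depend on
  \<open>D\<close>, but not on the piece \<open>A\<close>. A chain for \<open>mK\<close> at radii
  given by \<open>\<rho>\<close> then finishes the decomposition, and \<open>\<eta>\<close> turns
  its final bound into one for \<open>m\<close>.\<close>

theorem decomposable_with_fibering:
  fixes m :: "'a metric" and m' :: "'b metric" and mK :: "'c metric"
  assumes L: "0 < L" and p: "p \<in> mspace m \<rightarrow> mspace m'"
    and lip: "\<And>x y. x \<in> mspace m \<Longrightarrow> y \<in> mspace m \<Longrightarrow> mdist m' (p x) (p y) \<le> L * mdist m x y"
    and fibres: "\<And>D. \<exists>\<rho> \<eta>. mono \<rho> \<and> (\<forall>r. 0 < \<rho> r) \<and>
      (\<forall>A\<subseteq>mspace m'. (\<forall>a\<in>A. \<forall>b\<in>A. mdist m' a b \<le> D) \<longrightarrow>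
        (\<exists>f. coarse_embedding_on m mK \<rho> \<eta> {x\<in>mspace m. p x \<in> A} f))"
    and m': "decomposable_with m' s" and mK: "decomposable_with mK (\<lambda>_. j)"
  shows "decomposable_with m (\<lambda>R. max (s (2 * L * R)) j)"
  unfolding decomposable_with_def
proof (intro allI impI, elim conjE)
  fix R :: "nat \<Rightarrow> real" assume pos: "\<forall>i. 0 < R i" and R_Suc: "\<forall>i. R i \<le> R (Suc i)"
  \<comment> \<open>The radius \<open>2 * L * R i\<close> is \<open>L\<close> times
    \<open>2 * R i\<close>: the Lipschitz constant applied to the enlarged radius that the pullback
    requires.\<close>
  have "\<exists>n \<V>. 0 < n \<and> \<V> 0 = {m'} \<and>
      (\<forall>i<n. family_decomposes (\<V> i) (2 * L * R i) (s (2 * L * R i)) (\<V> (Suc i))) \<and>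
      uniformly_bounded_family (\<V> n)"
    using m'[unfolded decomposable_with_def, rule_format, of "\<lambda>i. 2 * L * R i"] pos R_Suc L by auto
  then obtain n \<V> where n: "0 < n" and \<V>0: "\<V> 0 = {m'}"
    and \<V>: "\<And>i. i < n \<Longrightarrow> family_decomposes (\<V> i) (2 * L * R i) (s (2 * L * R i)) (\<V> (Suc i))"
    and bdd: "uniformly_bounded_family (\<V> n)" by auto
  from bdd obtain D where
    D: "\<And>M x y. M \<in> \<V> n \<Longrightarrow> x \<in> mspace M \<Longrightarrow> y \<in> mspace M \<Longrightarrow> mdist M x y \<le> D"
    unfolding uniformly_bounded_family_iff by auto
  obtain \<rho> \<eta> where \<rho>: "mono \<rho>" "\<And>r. 0 < \<rho> r"
    and emb: "\<And>A. A \<subseteq> mspace m' \<Longrightarrow> (\<And>a b. a \<in> A \<Longrightarrow> b \<in> A \<Longrightarrow> mdist m' a b \<le> D) \<Longrightarrow>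
        \<exists>f. coarse_embedding_on m mK \<rho> \<eta> {x\<in>mspace m. p x \<in> A} f"
    using fibres[of D] by metis
  \<comment> \<open>The first \<open>n\<close> radii are spent, so this chain starts from
    \<open>R n\<close>. Monotonicity and positivity of \<open>\<rho>\<close> make the new radii an
    admissible sequence.\<close>
  have "\<exists>l \<V>'. 0 < l \<and> \<V>' 0 = {mK} \<and>
      (\<forall>i<l. family_decomposes (\<V>' i) (\<rho> (2 * R (n + i))) j (\<V>' (Suc i))) \<and>
      uniformly_bounded_family (\<V>' l)"
  proof (rule mK[unfolded decomposable_with_def, rule_format], intro conjI allI)
    show "\<rho> (2 * R (n + i)) \<le> \<rho> (2 * R (n + Suc i))" for i
      using R_Suc by (intro monoD[OF \<rho>(1)]) simp
  qed (rule \<rho>(2))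
  then obtain l \<V>' where \<V>'0: "\<V>' 0 = {mK}"
    and \<V>': "\<And>i. i < l \<Longrightarrow> family_decomposes (\<V>' i) (\<rho> (2 * R (n + i))) j (\<V>' (Suc i))"
    and bdd': "uniformly_bounded_family (\<V>' l)" by auto
  define P where "P i = pullback_family m m' {(mspace m, p)} (\<V> i)" for i
  define F where "F = {(Z, f). \<exists>A. A \<subseteq> mspace m' \<and> submetric m' A \<in> \<V> n \<and>
      Z = {x\<in>mspace m. p x \<in> A} \<and> coarse_embedding_on m mK \<rho> \<eta> Z f}"
  define Q where "Q i = pullback_family m mK F (\<V>' i)" for i
  \<comment> \<open>At the junction \<open>\<W> n\<close> is \<open>Q 0\<close>, not
    \<open>P n\<close>; hence the inclusion \<open>PQ\<close> below.\<close>
  define \<W> where "\<W> i = (if i < n then P i else Q (i - n))" for i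
  let ?k = "\<lambda>R. max (s (2 * L * R)) j"
  have P: "family_decomposes (P i) (R i) (?k (R i)) (P (Suc i))" if "i < n" for i
    unfolding P_def
  proof (rule family_decomposes_pullback)
    show "mdist m' (f x) (f y) \<le> 2 * L * R i"
      if "(Z, f) \<in> {(mspace m, p)}" "x \<in> Z" "y \<in> Z" "mdist m x y \<le> 2 * R i" for Z f x y
    proof -
      have "mdist m' (p x) (p y) \<le> L * mdist m x y" using lip that by auto
      also have "\<dots> \<le> L * (2 * R i)" using that L by (intro mult_left_mono) auto
      finally show ?thesis using that by simp
    qed
    show "R i < 2 * R i" using pos by (simp add: algebra_simps)
  qed (use \<V>[OF that] in auto)
  have Q: "family_decomposes (Q i) (R (n + i)) (?k (R (n + i))) (Q (Suc i))" if "i < l" for i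
    unfolding Q_def
  proof (rule family_decomposes_pullback)
    show "mdist mK (f x) (f y) \<le> \<rho> (2 * R (n + i))"
      if "(Z, f) \<in> F" "x \<in> Z" "y \<in> Z" "mdist m x y \<le> 2 * R (n + i)" for Z f x y
      using that by (auto simp: F_def coarse_embedding_on_def)
    show "R (n + i) < 2 * R (n + i)" using pos by (simp add: algebra_simps)
  qed (use \<V>'[OF that] in \<open>auto simp: F_def\<close>)
  have PQ: "P n \<subseteq> Q 0"
  proof
    fix M assume "M \<in> P n"
    then obtain A where A: "A \<subseteq> mspace m'" "submetric m' A \<in> \<V> n"
      and M: "M = submetric m {x\<in>mspace m. p x \<in> A}"
      by (auto simp: P_def pullback_family_def)
    have "mdist m' a b \<le> D" if "a \<in> A" "b \<in> A" for a b
      using D[OF A(2), of a b] that A(1) by auto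
    then obtain f where f: "coarse_embedding_on m mK \<rho> \<eta> {x\<in>mspace m. p x \<in> A} f"
      using emb[OF A(1)] by blast
    \<comment> \<open>As \<open>f\<close> maps into \<open>mspace mK\<close>, the piece is the
      preimage of the whole of \<open>mK\<close>, the only member of \<open>\<V>' 0\<close>.\<close>
    then have "M = submetric m {x \<in> {x\<in>mspace m. p x \<in> A}. f x \<in> mspace mK}"
      unfolding M coarse_embedding_on_def
      by (intro arg_cong[where f = "submetric m"]) auto
    moreover have "({x\<in>mspace m. p x \<in> A}, f) \<in> F" using A f by (auto simp: F_def)
    ultimately show "M \<in> Q 0"
      unfolding Q_def pullback_family_def \<V>'0 by fastforce
  qed
  have step: "family_decomposes (\<W> i) (R i) (?k (R i)) (\<W> (Suc i))" if "i < n + l" for i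
  proof (cases "i < n")
    case True
    then have "P (Suc i) \<subseteq> \<W> (Suc i)"
    proof (cases "Suc i < n")
      case False
      with True have "Suc i = n" by simp
      then show ?thesis using PQ by (simp add: \<W>_def)
    qed (simp add: \<W>_def)
    then show ?thesis using P[OF True] True family_decomposes_mono by (auto simp: \<W>_def)
  next
    case False
    then show ?thesis using Q[of "i - n"] that by (simp add: \<W>_def Suc_diff_le)
  qed
  have "\<W> 0 = {m}"
  proof -
    \<comment> \<open>A restriction equal to \<open>m'\<close> must be to all its points, so
      \<open>P 0\<close> contains only the preimage of the full space.\<close>
    have "B = mspace m'" if "B \<subseteq> mspace m'" "submetric m' B = m'" for B
      using that by (metis inf_absorb1 mspace_submetric)
    then have "B \<subseteq> mspace m' \<and> submetric m' B = m' \<longleftrightarrow> B = mspace m'" for B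
      by auto
    moreover have "{x \<in> mspace m. p x \<in> mspace m'} = mspace m" using p by auto
    ultimately show ?thesis
      using n \<V>0 by (simp add: \<W>_def P_def pullback_family_def)
  qed
  moreover have "uniformly_bounded_family (\<W> (n + l))"
  proof -
    obtain E where E: "\<And>M x y. M \<in> \<V>' l \<Longrightarrow> x \<in> mspace M \<Longrightarrow> y \<in> mspace M \<Longrightarrow> mdist M x y \<le> E"
      using bdd' unfolding uniformly_bounded_family_iff by auto
    have "mdist m x y \<le> \<eta> E"
      if F: "(Z, f) \<in> F" and B: "B \<subseteq> mspace mK" "submetric mK B \<in> \<V>' l"
        and xy: "x \<in> Z" "f x \<in> B" "y \<in> Z" "f y \<in> B" for Z f B x y
    proof -
      have "mdist mK (f x) (f y) \<le> E" using E[OF B(2), of "f x" "f y"] B xy by auto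
      then show ?thesis using F xy by (auto simp: F_def coarse_embedding_on_def)
    qed
    then show ?thesis
      unfolding uniformly_bounded_family_iff
      by (intro exI[of _ "\<eta> E"]) (auto simp: \<W>_def Q_def pullback_family_def)
  qed
  ultimately show "\<exists>n \<V>. 0 < n \<and> \<V> 0 = {m} \<and>
      (\<forall>i<n. family_decomposes (\<V> i) (R i) (?k (R i)) (\<V> (Suc i))) \<and>
      uniformly_bounded_family (\<V> n)"
    using n step by (intro exI[of _ "n + l"] exI[of _ \<W>]) auto
qed

section \<open>Group extensions\<close>

lemma mdist_word_metric_eq:
  assumes "group G" "symmetric_generating_set G S" "x \<in> carrier G" "y \<in> carrier G"
  shows "mdist (word_metric G S) x y = word_length G S (inv\<^bsub>G\<^esub> x \<otimes>\<^bsub>G\<^esub> y)"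
  using assms by (simp add: mdist_word_metric word_dist_def)

text \<open>Every element of the ball is the value of one of the finitely many words of length at
  most \<open>r\<close>.\<close>

lemma finite_word_ball:
  assumes "group G" "symmetric_generating_set G S" "finite S"
  shows "finite {g \<in> carrier G. real (word_length G S g) \<le> r}"
proof (rule finite_subset)
  let ?W = "{ws. set ws \<subseteq> S \<and> length ws \<le> nat \<lfloor>r\<rfloor>}"
  show "finite ((\<lambda>ws. foldr (\<otimes>\<^bsub>G\<^esub>) ws \<one>\<^bsub>G\<^esub>) ` ?W)"
    using finite_lists_length_le[OF assms(3)] by blast
  show "{g \<in> carrier G. real (word_length G S g) \<le> r} \<subseteq> (\<lambda>ws. foldr (\<otimes>\<^bsub>G\<^esub>) ws \<one>\<^bsub>G\<^esub>) ` ?W"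
  proof clarsimp
    fix g assume "g \<in> carrier G" "real (word_length G S g) \<le> r"
    then show "g \<in> (\<lambda>ws. foldr (\<otimes>\<^bsub>G\<^esub>) ws \<one>\<^bsub>G\<^esub>) ` ?W"
      using word_length_attained[OF assms(1,2), of g] by (force simp: le_nat_floor)
  qed
qed

text \<open>A word is mapped letter by letter, so the largest \<open>T\<close>-length of the image
  of a generator serves as \<open>L\<close>.\<close>

lemma hom_word_length_le:
  assumes "group_hom G H \<pi>" "symmetric_generating_set G S" "symmetric_generating_set H T" "finite S"
  obtains L where "1 \<le> L" and
    "\<And>g. g \<in> carrier G \<Longrightarrow> real (word_length H T (\<pi> g)) \<le> L * real (word_length G S g)"
proof -
  interpret group_hom G H \<pi> by fact
  \<comment> \<open>Inserting \<open>1\<close> gives \<open>1 \<le> L\<close> and keeps the maximum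
    defined when \<open>S\<close> is empty.\<close>
  define L where "L = Max (insert 1 ((\<lambda>x. word_length H T (\<pi> x)) ` S))"
  have SG: "S \<subseteq> carrier G" by (rule generators_closed(1)[OF G.is_group assms(2)])
  have L: "1 \<le> L" "\<And>x. x \<in> S \<Longrightarrow> word_length H T (\<pi> x) \<le> L"
    using assms(4) by (auto simp: L_def)
  have *: "word_length H T (\<pi> (foldr (\<otimes>\<^bsub>G\<^esub>) ws \<one>\<^bsub>G\<^esub>)) \<le> L * length ws" if "set ws \<subseteq> S" for ws
    using that
  proof (induction ws)
    case Nil
    then show ?case
      using word_length_eq_0[OF H.is_group assms(3), of "\<one>\<^bsub>H\<^esub>"] by simp
  next
    case (Cons a ws)
    let ?w = "foldr (\<otimes>\<^bsub>G\<^esub>) ws \<one>\<^bsub>G\<^esub>"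
    have "?w \<in> carrier G" "a \<in> carrier G"
      using Cons.prems SG word_closed[OF G.is_group assms(2)] by auto
    then have "word_length H T (\<pi> (a \<otimes>\<^bsub>G\<^esub> ?w)) \<le> word_length H T (\<pi> a) + word_length H T (\<pi> ?w)"
      using word_length_mult_le[OF H.is_group assms(3)] by simp
    also have "\<dots> \<le> L + L * length ws" using Cons L(2)[of a] by (intro add_mono) auto
    finally show ?case by simp
  qed
  have "real (word_length H T (\<pi> g)) \<le> real L * real (word_length G S g)" if g: "g \<in> carrier G" for g
  proof -
    have "word_length H T (\<pi> g) \<le> L * word_length G S g"
      using word_length_attained[OF G.is_group assms(2) g] * by metis
    then show ?thesis by (metis of_nat_le_iff of_nat_mult)
  qed
  then show thesis using that[of "real L"] L(1) by simp
qed

lemma left_invariant_mdist: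
  assumes "group K" "proper_left_invariant_metric K mK" "x \<in> carrier K" "y \<in> carrier K"
  shows "mdist mK x y = mdist mK \<one>\<^bsub>K\<^esub> (inv\<^bsub>K\<^esub> x \<otimes>\<^bsub>K\<^esub> y)"
proof -
  interpret group K by fact
  have "mdist mK (inv\<^bsub>K\<^esub> x \<otimes>\<^bsub>K\<^esub> x) (inv\<^bsub>K\<^esub> x \<otimes>\<^bsub>K\<^esub> y) = mdist mK x y"
    using assms(2) inv_closed[OF assms(3)] assms(3,4)
    unfolding proper_left_invariant_metric_def by blast
  then show ?thesis using assms(3) by simp
qed

text \<open>
  The extra \<open>1\<close> makes the bound positive; the maximum is only meaningful when the sublevel
  sets of \<open>f\<close> are finite.
\<close>
definition sublevel_bound :: "'a set \<Rightarrow> ('a \<Rightarrow> real) \<Rightarrow> ('a \<Rightarrow> real) \<Rightarrow> real \<Rightarrow> real" where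
  "sublevel_bound A f g r = Max (insert 1 (g ` {x\<in>A. f x \<le> r}))"

text \<open>Finite sublevel sets of \<open>f\<close> make \<open>sublevel_bound\<close> a control
  function bounding \<open>g\<close> in terms of \<open>f\<close>; it is monotone because the
  sublevel sets grow with \<open>r\<close>.\<close>

lemma
  assumes "\<And>r. finite {x\<in>A. f x \<le> r}"
  shows sublevel_bound_pos: "0 < sublevel_bound A f g r"
    and mono_sublevel_bound: "mono (sublevel_bound A f g)"
    and sublevel_bound: "x \<in> A \<Longrightarrow> f x \<le> r \<Longrightarrow> g x \<le> sublevel_bound A f g r"
proof -
  have "1 \<le> sublevel_bound A f g r"
    using assms unfolding sublevel_bound_def by (intro Max_ge) auto
  then show "0 < sublevel_bound A f g r" by linarith
  show "mono (sublevel_bound A f g)"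
    unfolding sublevel_bound_def using assms by (intro monoI Max_mono) auto
  show "x \<in> A \<Longrightarrow> f x \<le> r \<Longrightarrow> g x \<le> sublevel_bound A f g r"
    unfolding sublevel_bound_def using assms by (intro Max_ge) auto
qed

text \<open>After translation by the inverse of some \<open>g\<close> in the preimage, the points
  project into the \<open>D\<close>-ball of \<open>H\<close>. This ball is finite, so its elements
  have lifts of length at most some \<open>C\<close>. Dividing by the lift on the right lands in the
  kernel and moves each point by at most \<open>C\<close>. What remains is to compare two length
  functions on \<open>K\<close> with finite balls: that of \<open>mK\<close> and the word length of
  \<open>G\<close>.\<close>

lemma preimages_coarsely_embed:
  fixes K :: "('k, 'kx) monoid_scheme" and G :: "('g, 'gx) monoid_scheme"
    and H :: "('h, 'hx) monoid_scheme" and D :: real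
  assumes K: "group K" and G: "group G" and H: "group H"
    and \<iota>: "\<iota> \<in> mon K G" and \<pi>: "\<pi> \<in> epi G H" and exact: "\<iota> ` carrier K = kernel G H \<pi>"
    and mK: "proper_left_invariant_metric K mK"
    and SG: "finite SG" "symmetric_generating_set G SG"
    and SH: "finite SH" "symmetric_generating_set H SH"
  shows "\<exists>\<rho> \<eta>. mono \<rho> \<and> (\<forall>r. 0 < \<rho> r) \<and>
      (\<forall>A\<subseteq>carrier H. (\<forall>a\<in>A. \<forall>b\<in>A. mdist (word_metric H SH) a b \<le> D) \<longrightarrow>
        (\<exists>f. coarse_embedding_on (word_metric G SG) mK \<rho> \<eta> {x\<in>carrier G. \<pi> x \<in> A} f))"
proof -
  interpret K: group K by fact
  interpret G: group G by fact
  interpret H: group H by fact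
  interpret \<iota>: group_hom K G \<iota> using \<iota> by unfold_locales (simp add: mon_def)
  interpret \<pi>: group_hom G H \<pi> using \<pi> by unfold_locales (simp add: epi_def)
  have inj: "inj_on \<iota> (carrier K)" using \<iota> by (simp add: mon_def)
  have mspaceK: "mspace mK = carrier K" using mK by (simp add: proper_left_invariant_metric_def)
  define lG where "lG g = real (word_length G SG g)" for g
  define lK where "lK = mdist mK \<one>\<^bsub>K\<^esub>"
  have distG: "mdist (word_metric G SG) x y = lG (inv\<^bsub>G\<^esub> x \<otimes>\<^bsub>G\<^esub> y)"
    if "x \<in> carrier G" "y \<in> carrier G" for x y
    using mdist_word_metric_eq[OF G SG(2) that] by (simp add: lG_def)
  have distK: "mdist mK x y = lK (inv\<^bsub>K\<^esub> x \<otimes>\<^bsub>K\<^esub> y)" if "x \<in> carrier K" "y \<in> carrier K" for x y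
    using left_invariant_mdist[OF K mK that] by (simp add: lK_def)
  have lG_mult: "lG (x \<otimes>\<^bsub>G\<^esub> y) \<le> lG x + lG y" if "x \<in> carrier G" "y \<in> carrier G" for x y
    using word_length_mult_le[OF G SG(2) that] by (simp add: lG_def)
  have lG_inv: "lG (inv\<^bsub>G\<^esub> x) = lG x" if "x \<in> carrier G" for x
    using word_length_inv[OF G SG(2) that] by (simp add: lG_def)
  define \<sigma> where "\<sigma> = inv_into (carrier G) \<pi>"
  have surj: "\<pi> ` carrier G = carrier H" using \<pi> by (simp add: epi_def)
  have \<sigma>: "\<sigma> h \<in> carrier G" "\<pi> (\<sigma> h) = h" if "h \<in> carrier H" for h
    using that surj unfolding \<sigma>_def by (auto intro: inv_into_into f_inv_into_f)
  \<comment> \<open>A bound for the lengths of the chosen lifts of the \<open>D\<close>-ball; it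
    depends on \<open>D\<close> but not on \<open>A\<close>.\<close>
  define C where "C = sublevel_bound (carrier H) (\<lambda>h. real (word_length H SH h)) (lG \<circ> \<sigma>) D"
  have C: "lG (\<sigma> h) \<le> C" if "h \<in> carrier H" "real (word_length H SH h) \<le> D" for h
    using sublevel_bound[of "carrier H" "\<lambda>h. real (word_length H SH h)" h D "lG \<circ> \<sigma>"] that
      finite_word_ball[OF H SH(2,1)] by (simp add: C_def)
  have fin1: "finite {k \<in> carrier K. lG (\<iota> k) \<le> r}" for r
  proof (rule inj_on_finite)
    show "inj_on \<iota> {k \<in> carrier K. lG (\<iota> k) \<le> r}" using inj by (rule inj_on_subset) auto
    show "\<iota> ` {k \<in> carrier K. lG (\<iota> k) \<le> r} \<subseteq> {g \<in> carrier G. real (word_length G SG g) \<le> r}"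
      by (auto simp: lG_def)
  qed (rule finite_word_ball[OF G SG(2,1)])
  have fin2: "finite {k \<in> carrier K. lK k \<le> r}" for r
  proof -
    have "{k \<in> carrier K. lK k \<le> r} = mcball_of mK \<one>\<^bsub>K\<^esub> r"
      by (auto simp: lK_def mspaceK)
    then show ?thesis using mK by (simp add: proper_left_invariant_metric_def)
  qed
  \<comment> \<open>The term \<open>2 * C\<close> pays for moving both points of a pair into the
    kernel.\<close>
  define \<rho> where "\<rho> r = sublevel_bound (carrier K) (lG \<circ> \<iota>) lK (r + 2 * C)" for r
  define \<eta> where "\<eta> r = sublevel_bound (carrier K) lK (lG \<circ> \<iota>) r + 2 * C" for r
  have \<rho>: "lK k \<le> \<rho> r" if "k \<in> carrier K" "lG (\<iota> k) \<le> r + 2 * C" for k r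
    unfolding \<rho>_def using that fin1 by (intro sublevel_bound) auto
  have \<eta>: "lG (\<iota> k) + 2 * C \<le> \<eta> r" if "k \<in> carrier K" "lK k \<le> r" for k r
    unfolding \<eta>_def
    using that fin2 sublevel_bound[of "carrier K" lK k r "lG \<circ> \<iota>"] by auto
  have "\<exists>f. coarse_embedding_on (word_metric G SG) mK \<rho> \<eta> {x\<in>carrier G. \<pi> x \<in> A} f"
    if A: "A \<subseteq> carrier H" "\<And>a b. a \<in> A \<Longrightarrow> b \<in> A \<Longrightarrow> mdist (word_metric H SH) a b \<le> D" for A
  proof (cases "{x\<in>carrier G. \<pi> x \<in> A} = {}")
    case True
    then show ?thesis unfolding True by (auto simp: coarse_embedding_on_def)
  next
    case False
    then obtain g where g: "g \<in> carrier G" "\<pi> g \<in> A" by auto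
    let ?Z = "{x\<in>carrier G. \<pi> x \<in> A}"
    \<comment> \<open>The short lift of the projection of the translated point; both have the same
      image in \<open>H\<close>, so their quotient is in the kernel.\<close>
    define c where "c x = \<sigma> (\<pi> (inv\<^bsub>G\<^esub> g \<otimes>\<^bsub>G\<^esub> x))" for x
    have c: "c x \<in> carrier G" "\<pi> (c x) = \<pi> (inv\<^bsub>G\<^esub> g \<otimes>\<^bsub>G\<^esub> x)" "lG (c x) \<le> C" if x: "x \<in> ?Z" for x
    proof -
      have *: "\<pi> (inv\<^bsub>G\<^esub> g \<otimes>\<^bsub>G\<^esub> x) \<in> carrier H" using g x by auto
      have "real (word_length H SH (\<pi> (inv\<^bsub>G\<^esub> g \<otimes>\<^bsub>G\<^esub> x))) = mdist (word_metric H SH) (\<pi> g) (\<pi> x)"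
        using g x by (subst mdist_word_metric_eq[OF H SH(2)]) auto
      then show "lG (c x) \<le> C" using A(2)[of "\<pi> g" "\<pi> x"] g x C[OF *] by (simp add: c_def)
    qed (use g x \<sigma> in \<open>auto simp: c_def\<close>)
    define f where "f x = inv_into (carrier K) \<iota> (inv\<^bsub>G\<^esub> g \<otimes>\<^bsub>G\<^esub> x \<otimes>\<^bsub>G\<^esub> inv\<^bsub>G\<^esub> (c x))" for x
    have f: "f x \<in> carrier K" "\<iota> (f x) = inv\<^bsub>G\<^esub> g \<otimes>\<^bsub>G\<^esub> x \<otimes>\<^bsub>G\<^esub> inv\<^bsub>G\<^esub> (c x)" if x: "x \<in> ?Z" for x
    proof -
      have "\<pi> (inv\<^bsub>G\<^esub> g \<otimes>\<^bsub>G\<^esub> x \<otimes>\<^bsub>G\<^esub> inv\<^bsub>G\<^esub> (c x)) = \<pi> (c x) \<otimes>\<^bsub>H\<^esub> inv\<^bsub>H\<^esub> \<pi> (c x)"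
        using g x c(1)[OF x] by (simp add: c(2)[OF x])
      then have "inv\<^bsub>G\<^esub> g \<otimes>\<^bsub>G\<^esub> x \<otimes>\<^bsub>G\<^esub> inv\<^bsub>G\<^esub> (c x) \<in> \<iota> ` carrier K"
        using g x c(1)[OF x] unfolding exact kernel_def by simp
      then show "f x \<in> carrier K" "\<iota> (f x) = inv\<^bsub>G\<^esub> g \<otimes>\<^bsub>G\<^esub> x \<otimes>\<^bsub>G\<^esub> inv\<^bsub>G\<^esub> (c x)"
        unfolding f_def by (rule inv_into_into, rule f_inv_into_f)
    qed
    have "coarse_embedding_on (word_metric G SG) mK \<rho> \<eta> ?Z f"
      unfolding coarse_embedding_on_def
    proof (intro conjI ballI allI)
      show "f \<in> ?Z \<rightarrow> mspace mK" using f mspaceK by auto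
    next
      fix x y r assume xy: "x \<in> ?Z" "y \<in> ?Z"
      define k where "k = inv\<^bsub>K\<^esub> (f x) \<otimes>\<^bsub>K\<^esub> f y"
      define z where "z = inv\<^bsub>G\<^esub> x \<otimes>\<^bsub>G\<^esub> y"
      have carr: "k \<in> carrier K" "z \<in> carrier G" "x \<in> carrier G" "y \<in> carrier G"
        "c x \<in> carrier G" "c y \<in> carrier G"
        using f[OF xy(1)] f[OF xy(2)] c(1) xy by (auto simp: k_def z_def)
      \<comment> \<open>The base point \<open>g\<close> drops out of the difference of two images,
        which makes the controls independent of the piece.\<close>
      have cancel: "(inv\<^bsub>G\<^esub> x \<otimes>\<^bsub>G\<^esub> g) \<otimes>\<^bsub>G\<^esub> (inv\<^bsub>G\<^esub> g \<otimes>\<^bsub>G\<^esub> w) = inv\<^bsub>G\<^esub> x \<otimes>\<^bsub>G\<^esub> w"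
        if "w \<in> carrier G" for w
        using g carr that by (metis G.inv_closed G.inv_solve_left G.m_assoc G.m_closed)
      have "\<iota> k = inv\<^bsub>G\<^esub> (\<iota> (f x)) \<otimes>\<^bsub>G\<^esub> \<iota> (f y)"
        using f[OF xy(1)] f[OF xy(2)] by (simp add: k_def)
      also have "\<dots> = c x \<otimes>\<^bsub>G\<^esub> ((inv\<^bsub>G\<^esub> x \<otimes>\<^bsub>G\<^esub> g) \<otimes>\<^bsub>G\<^esub> (inv\<^bsub>G\<^esub> g \<otimes>\<^bsub>G\<^esub> (y \<otimes>\<^bsub>G\<^esub> inv\<^bsub>G\<^esub> (c y))))"
        using f(2)[OF xy(1)] f(2)[OF xy(2)] g carr by (simp add: G.inv_mult_group G.m_assoc)
      also have "\<dots> = c x \<otimes>\<^bsub>G\<^esub> (inv\<^bsub>G\<^esub> x \<otimes>\<^bsub>G\<^esub> (y \<otimes>\<^bsub>G\<^esub> inv\<^bsub>G\<^esub> (c y)))"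
        using carr by (subst cancel) auto
      finally have k: "\<iota> k = c x \<otimes>\<^bsub>G\<^esub> (z \<otimes>\<^bsub>G\<^esub> inv\<^bsub>G\<^esub> (c y))"
        using carr by (simp add: z_def G.m_assoc)
      \<comment> \<open>The same relation solved for \<open>z\<close>: the triangle inequality
        applied to both forms shows that the lengths of \<open>z\<close> and
        \<open>\<iota> k\<close> differ by at most \<open>2 * C\<close>.\<close>
      then have z: "z = inv\<^bsub>G\<^esub> (c x) \<otimes>\<^bsub>G\<^esub> (\<iota> k \<otimes>\<^bsub>G\<^esub> c y)"
        using carr by (simp add: G.m_assoc G.inv_solve_left)
      have "lG (\<iota> k) \<le> lG (c x) + (lG z + lG (inv\<^bsub>G\<^esub> (c y)))"
        unfolding k using carr lG_mult[of "c x" "z \<otimes>\<^bsub>G\<^esub> inv\<^bsub>G\<^esub> (c y)"] lG_mult[of z "inv\<^bsub>G\<^esub> (c y)"] by simp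
      then have up: "lG (\<iota> k) \<le> lG z + 2 * C"
        using c(3)[OF xy(1)] c(3)[OF xy(2)] lG_inv[of "c y"] carr by simp
      have "lG z \<le> lG (inv\<^bsub>G\<^esub> (c x)) + (lG (\<iota> k) + lG (c y))"
        using carr lG_mult[of "inv\<^bsub>G\<^esub> (c x)" "\<iota> k \<otimes>\<^bsub>G\<^esub> c y"] lG_mult[of "\<iota> k" "c y"]
        by (subst z) simp
      then have lo: "lG z \<le> lG (\<iota> k) + 2 * C"
        using c(3)[OF xy(1)] c(3)[OF xy(2)] lG_inv[of "c x"] carr by simp
      have dists: "mdist (word_metric G SG) x y = lG z" "mdist mK (f x) (f y) = lK k"
        using distG distK f xy by (auto simp: z_def k_def)
      show "mdist (word_metric G SG) x y \<le> r \<longrightarrow> mdist mK (f x) (f y) \<le> \<rho> r"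
        using \<rho>[OF carr(1), of r] up by (auto simp: dists)
      show "mdist mK (f x) (f y) \<le> r \<longrightarrow> mdist (word_metric G SG) x y \<le> \<eta> r"
        using \<eta>[OF carr(1), of r] lo by (auto simp: dists)
    qed
    then show ?thesis by blast
  qed
  moreover have "mono \<rho>"
    using monoD[OF mono_sublevel_bound[of "carrier K" "lG \<circ> \<iota>" lK]] fin1
    by (intro monoI) (simp add: \<rho>_def)
  moreover have "\<forall>r. 0 < \<rho> r"
    using sublevel_bound_pos[of "carrier K" "lG \<circ> \<iota>"] fin1 by (simp add: \<rho>_def)
  ultimately show ?thesis by (intro exI[of _ \<rho>] exI[of _ \<eta>]) auto
qed

theorem theorem4p3:
  fixes K :: "('k, 'kx) monoid_scheme" and G :: "('g, 'gx) monoid_scheme"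
    and H :: "('h, 'hx) monoid_scheme"
    and \<iota> :: "'k \<Rightarrow> 'g" and \<pi> :: "'g \<Rightarrow> 'h"
    and mK :: "'k metric" and SG :: "'g set" and SH :: "'h set"
    and s :: "real \<Rightarrow> nat"
  assumes "group K" and "group G" and "group H"
    and "\<iota> \<in> mon K G" and "\<pi> \<in> epi G H" and "\<iota> ` carrier K = kernel G H \<pi>"
    and "countable (carrier K)" and "proper_left_invariant_metric K mK" and "straight_FDC mK"
    and "finite SG" and "symmetric_generating_set G SG"
    and "finite SH" and "symmetric_generating_set H SH"
    and "decomposition_complexity_growth (word_metric H SH) s"
  shows "\<exists>t. decomposition_complexity_growth (word_metric G SG) t \<and> same_growth t s"
proof -
  have hom: "group_hom G H \<pi>"
    using assms by (simp add: group_hom_def group_hom_axioms_def epi_def)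
  interpret group_hom G H \<pi> by (rule hom)
  note mspaces = mspace_word_metric[OF assms(2,11)] mspace_word_metric[OF assms(3,13)]
  obtain L where L: "1 \<le> L" and
    lip: "\<And>g. g \<in> carrier G \<Longrightarrow> real (word_length H SH (\<pi> g)) \<le> L * real (word_length G SG g)"
    using hom_word_length_le[OF hom assms(11,13,10)] by metis
  define t where "t R = max (s (2 * L * R)) 2" for R
  have s: "mono_on {0<..} s" "decomposable_with (word_metric H SH) s"
    using assms(14) by (auto simp: decomposition_complexity_growth_def)
  have "decomposable_with (word_metric G SG) t"
    unfolding t_def
  proof (rule decomposable_with_fibering[where p = \<pi>])
    show "mdist (word_metric H SH) (\<pi> x) (\<pi> y) \<le> L * mdist (word_metric G SG) x y"
      if "x \<in> mspace (word_metric G SG)" "y \<in> mspace (word_metric G SG)" for x y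
      using that lip[of "inv\<^bsub>G\<^esub> x \<otimes>\<^bsub>G\<^esub> y"]
      by (simp add: mspaces mdist_word_metric_eq[OF assms(2,11)] mdist_word_metric_eq[OF assms(3,13)])
    show "decomposable_with mK (\<lambda>_. 2)" using assms(9) by (simp add: straight_FDC_def)
  qed (use L s preimages_coarsely_embed[OF assms(1-6,8,10-13)] in \<open>auto simp: mspaces\<close>)
  moreover have "mono_on {0<..} t"
    using s(1) L by (auto simp: mono_on_def t_def intro: max.mono le_max_iff_disj[THEN iffD2])
  moreover have "same_growth t s"
    unfolding same_growth_def
  \<comment> \<open>The additive constant \<open>2\<close> absorbs the maximum with \<open>2\<close>
    in \<open>t\<close>. In the other direction \<open>2 * L * (2 * L)\<close> is at least
    \<open>1\<close>, so monotonicity of \<open>s\<close> suffices.\<close>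
  proof (rule exI[of _ "2 * L"], intro conjI exI[of _ 2] allI impI)
    fix x :: real assume x: "0 < x"
    have "1 \<le> 2 * L * (2 * L)" using L mult_mono[of 1 "2 * L" 1 "2 * L"] by simp
    then have "x \<le> 2 * L * (2 * L * x)" using x by (metis mult.assoc mult_right_mono mult_1 less_imp_le)
    then have "s x \<le> t (2 * L * x)"
      using mono_onD[OF s(1), of x "2 * L * (2 * L * x)"] x L by (auto simp: t_def)
    then show "real (s x) - 2 \<le> real (t (2 * L * x))" by linarith
    show "real (t x) - 2 \<le> real (s (2 * L * x))" by (simp add: t_def)
  qed (use L in auto)
  ultimately show ?thesis by (auto simp: decomposition_complexity_growth_def)
qed

end
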